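(* Let $A=(a_{ij})\in\mathbb{R}_+^{n\times n}$, let $\tau\in\mathcal{C}^{=1}(A)$ and let $x^\tau=x^{(\tau,i)}$ for some $i\in\operatorname{supp}(\tau)$. Then $x^\tau$ is not an extremal of $V^*(A)$ if and only if there exist two edges $(k_1,l_1)$ and $(k_2,l_2)$ of $\mathcal{D}(A)$ such that $k_1,l_1,k_2,l_2\in\operatorname{supp}(\tau)$, $l_1\neq\tau(k_1)$, $l_2\neq\tau(k_2)$, $k_1\neq k_2$, $a_{k_1,l_1}\cdot w(P^\tau_{l_1k_1})\ge1$ and $a_{k_2,l_2}\cdot w(P^\tau_{l_2k_2})\ge1$.
   Context: Max algebra on $\mathbb{R}_+=[0,\infty)$ with $a\oplus b=\max(a,b)$ and ordinary multiplication; $(A\otimes x)_i=\max_j a_{ij}x_j$; $V^*(A)=\{x\in\mathbb{R}_+^n: A\otimes x\ge x\}$ (componentwise). An element $u$ of $V^*(A)$ is an extremal if whenever $u=v\oplus w$ (componentwise max) with $v,w\in V^*(A)$, one has $u=v$ or $u=w$. $\mathcal{D}(A)$ is the digraph on $[n]$ with an edge $(i,j)$ of weight $a_{ij}$ whenever $a_{ij}\neq0$; walk weights $w(\cdot)$ are products of edge weights. A cycle of $\mathcal{D}(A)$ with distinct nodes $i_1,\dots,i_p$ (edges $(i_1,i_2),\dots,(i_{p-1},i_p),(i_p,i_1)$) is identified with the map $\tau$ on $\operatorname{supp}(\tau)=\{i_1,\dots,i_p\}$ given by $\tau(i_s)=i_{s+1}$, $\tau(i_p)=i_1$; $\mathcal{C}^{=1}(A)$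 is the set of such cycles of weight exactly $1$. For $k,j\in\operatorname{supp}(\tau)$, $P^\tau_{kj}$ denotes the walk from $k$ to $j$ along the cycle (following $\tau$) not repeating nodes (of weight $1$ if $k=j$). Define $x^{(\tau,k)}\in\mathbb{R}_+^n$ for $k\in\operatorname{supp}(\tau)$ by $x^{(\tau,k)}_j=(w(P^\tau_{kj}))^{-1}$ for $j\in\operatorname{supp}(\tau)$ (so $x^{(\tau,k)}_k=1$) and $x^{(\tau,k)}_j=0$ for $j\notin\operatorname{supp}(\tau)$. (When the cycle has weight $1$, these vectors are all proportional to each other.) *)

theory Defs
  imports "HOL-Analysis.Analysis"
begin

definition max_mult :: "real^'n^'n \<Rightarrow> real^'n \<Rightarrow> real^'n"  (infixr "\<otimes>\<^sub>m" 70)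
  where "A \<otimes>\<^sub>m x = (\<chi> i. Max (range (\<lambda>j. A $ i $ j * x $ j)))"

definition max_add :: "real^'n \<Rightarrow> real^'n \<Rightarrow> real^'n"  (infixl "\<oplus>\<^sub>m" 65)
  where "v \<oplus>\<^sub>m w = (\<chi> i. max (v $ i) (w $ i))"

text \<open>The order \<open>\<le>\<close> on \<^typ>\<open>real^'n\<close> is the componentwise one.\<close>

definition Vstar :: "real^'n^'n \<Rightarrow> (real^'n) set"
  where "Vstar A = {x. 0 \<le> x \<and> x \<le> A \<otimes>\<^sub>m x}"

definition extremal :: "(real^'n) set \<Rightarrow> real^'n \<Rightarrow> bool"
  where "extremal V u \<longleftrightarrow>
    u \<in> V \<and> (\<forall>v\<in>V. \<forall>w\<in>V. u = v \<oplus>\<^sub>m w \<longrightarrow> u = v \<or> u = w)"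

definition edges :: "real^'n^'n \<Rightarrow> ('n \<times> 'n) set"
  where "edges A = {(i, j). A $ i $ j \<noteq> 0}"

text \<open>Walks are given by their nonempty lists of nodes; a single node is a walk of weight 1.\<close>

definition walk :: "real^'n^'n \<Rightarrow> 'n list \<Rightarrow> bool"
  where "walk A p \<longleftrightarrow> p \<noteq> [] \<and> successively (\<lambda>i j. (i, j) \<in> edges A) p"

fun walk_weight :: "real^'n^'n \<Rightarrow> 'n list \<Rightarrow> real"
  where
    "walk_weight A (i # j # p) = A $ i $ j * walk_weight A (j # p)"
  | "walk_weight A p = 1"

text \<open>
  The cycle with distinct nodes \<open>i\<^sub>1, \<dots>, i\<^sub>p\<close>, as a partial map sending each \<open>i\<^sub>s\<close> to \<open>i\<^bsub>s+1\<^esub>\<close>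
  and \<open>i\<^sub>p\<close> to \<open>i\<^sub>1\<close>. Its support is the domain of the partial map, so that a loop
  at \<open>i\<close> has support \<open>{i}\<close>.
\<close>

definition cycle_map :: "'n list \<Rightarrow> 'n \<rightharpoonup> 'n"
  where "cycle_map p = map_of (zip p (rotate1 p))"

definition unit_cycles :: "real^'n^'n \<Rightarrow> ('n \<rightharpoonup> 'n) set"
  where "unit_cycles A =
    {cycle_map p | p. p \<noteq> [] \<and> distinct p \<and>
       walk A (p @ [hd p]) \<and> walk_weight A (p @ [hd p]) = 1}"

text \<open>
  The walk from \<open>k\<close> to \<open>j\<close> along \<open>\<tau>\<close> without repeated nodes; it exists and is unique
  when \<open>\<tau>\<close> is a cycle and \<open>k\<close>, \<open>j\<close> lie in its support.
\<close>

definition cycle_path :: "('n \<rightharpoonup> 'n) \<Rightarrow> 'n \<Rightarrow> 'n \<Rightarrow> 'n list"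
  where "cycle_path \<tau> k j =
    (THE p. p \<noteq> [] \<and> hd p = k \<and> last p = j \<and> distinct p \<and>
       successively (\<lambda>u v. \<tau> u = Some v) p)"

definition cycle_vec :: "real^'n^'n \<Rightarrow> ('n \<rightharpoonup> 'n) \<Rightarrow> 'n \<Rightarrow> real^'n"
  where "cycle_vec A \<tau> k =
    (\<chi> j. if j \<in> dom \<tau> then inverse (walk_weight A (cycle_path \<tau> k j)) else 0)"

end

theory Submission
  imports Defs
begin

text \<open>
  Let \<open>x\<close> be the cycle vector and \<open>\<tau>\<close> the cycle. Since \<open>\<tau>\<close> has weight 1, \<open>x\<close> is a potential:
  \<open>a\<^bsub>k,\<tau>(k)\<^esub> x\<^bsub>\<tau>(k)\<^esub> = x\<^sub>k\<close> on the support and \<open>w(P\<^sub>l\<^sub>k) = x\<^sub>l / x\<^sub>k\<close>. Hence the condition on an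
  edge \<open>(k, l)\<close> off the cycle says that \<open>l\<close> can replace \<open>\<tau>(k)\<close> as the witness of
  \<open>x\<^sub>k \<le> (A \<otimes> x)\<^sub>k\<close>. With such an edge, \<open>x\<close> stays in \<open>V\<^sup>*(A)\<close> after its entry at \<open>\<tau>(k)\<close> is set to 0,
  and two such edges with different \<open>k\<close> give two vectors with maximum \<open>x\<close>. Conversely, if
  \<open>x = v \<oplus> w\<close> with \<open>v, w \<noteq> x\<close>, then the cycle leaves the set \<open>{v = x}\<close> at some \<open>k\<^sub>1\<close> and the set
  \<open>{w = x}\<close> at some \<open>k\<^sub>2\<close>; each must have a witness off the cycle, and \<open>k\<^sub>1 \<noteq> k\<^sub>2\<close> because at every
  node \<open>v\<close> or \<open>w\<close> agrees with \<open>x\<close>.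
\<close>

text \<open>A maximum of finitely many terms dominates \<open>x $ k\<close> as soon as one term
  does, so membership reduces to one witness index per row.\<close>

lemma mem_Vstar_iff:
  "x \<in> Vstar A \<longleftrightarrow> (\<forall>k. 0 \<le> x $ k \<and> (\<exists>l. x $ k \<le> A $ k $ l * x $ l))"
  unfolding Vstar_def max_mult_def less_eq_vec_def
  by (auto simp: Max_ge_iff)

section \<open>Walk weights and paths of a partial map\<close>

lemma walk_weight_pos:
  assumes "\<forall>r s. 0 \<le> A $ r $ s" "successively (\<lambda>i j. (i, j) \<in> edges A) p"
  shows "0 < walk_weight A p"
  using assms(2)
proof (induction p rule: induct_list012)
  case (3 i j p)
  then have "0 < A $ i $ j"
    using assms(1) by (simp add: edges_def less_le)
  with 3 show ?case by simp
qed auto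

text \<open>The product telescopes, each edge contributing a quotient of consecutive values of
  \<open>y\<close>.\<close>

lemma walk_weight_potential:
  assumes "p \<noteq> []" "successively R p"
    and "\<And>u v. R u v \<Longrightarrow> A $ u $ v = y u / y v \<and> y u \<noteq> 0 \<and> y v \<noteq> (0::real)"
    and "y (hd p) \<noteq> 0"
  shows "walk_weight A p = y (hd p) / y (last p)"
  using assms
proof (induction p rule: induct_list012)
  case (3 i j p)
  then have "R i j" by simp
  then have ij: "A $ i $ j = y i / y j" "y j \<noteq> 0" using "3.prems"(3) by blast+
  have "walk_weight A (j # p) = y j / y (last (j # p))"
    using "3.IH"(2)[OF _ _ "3.prems"(3)] "3.prems"(2) ij by simp
  with ij show ?case by simp
qed auto

text \<open>The map \<open>f\<close> forces every next node, and distinctness forbids running on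
  past the common last node. This justifies the \<open>THE\<close> in
  \<open>cycle_path\<close>.\<close>

lemma distinct_functional_path_unique:
  assumes "p \<noteq> []" "q \<noteq> []" "hd p = hd q" "last p = last q" "distinct p" "distinct q"
    and "successively (\<lambda>u v. f u = Some v) p" "successively (\<lambda>u v. f u = Some v) q"
  shows "p = q"
  using assms
proof (induction p arbitrary: q rule: induct_list012)
  case 1
  then show ?case by simp
next
  case (2 k)
  then show ?case by (cases q) (auto split: if_splits)
next
  case (3 k a p)
  obtain b q' where q: "q = k # b # q'"
  \<comment> \<open>The rule only splits lists by length 0, 1 or more. If \<open>q\<close> were
    \<open>[k]\<close>, the other path would have to return to \<open>k\<close>.\<close>
  proof (cases q rule: remdups_adj.cases)
    case (2 z)
    with 3 have "last (a # p) = k" by simp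
    moreover have "k \<notin> set (a # p)" using 3 by simp
    ultimately show ?thesis by (metis last_in_set list.distinct(1))
  qed (use 3 that in auto)
  have "a # p = b # q'"
    by (rule "3.IH"(2)) (use 3 q in auto)
  with q show ?case by simp
qed

lemma successively_leaves:
  assumes "p \<noteq> []" "successively R p" "hd p \<in> U" "last p \<notin> U"
  shows "\<exists>u v. R u v \<and> u \<in> U \<and> v \<notin> U"
  using assms by (induction p rule: induct_list012) auto

section \<open>The cycle of a list and its potential\<close>

lemma cycle_map_nth:
  assumes "distinct p" "s < length p"
  shows "cycle_map p (p ! s) = Some (p ! (Suc s mod length p))"
  using assms map_of_zip_nth[of p "rotate1 p" s]
  by (simp add: cycle_map_def nth_rotate1)

lemma dom_cycle_map: "dom (cycle_map p) = set p"
  by (simp add: cycle_map_def)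

lemma ran_cycle_map: "distinct p \<Longrightarrow> ran (cycle_map p) = set p"
  by (simp add: cycle_map_def ran_map_of_zip)

lemma inj_on_cycle_map:
  assumes "distinct p"
  shows "inj_on (cycle_map p) (set p)"
proof (rule inj_onI)
  fix u v assume "u \<in> set p" "v \<in> set p" and eq: "cycle_map p u = cycle_map p v"
  then obtain s t where st: "s < length p" "u = p ! s" "t < length p" "v = p ! t"
    by (metis in_set_conv_nth)
  with eq assms have "rotate1 p ! s = rotate1 p ! t"
    by (simp add: cycle_map_nth nth_rotate1)
  with st assms show "u = v"
    by (simp add: nth_eq_iff_index_eq)
qed

text \<open>Rotate the node list so that it starts at \<open>k\<close>, then cut it after
  \<open>j\<close>.\<close>

lemma cycle_map_path_exists:
  assumes "distinct p" "k \<in> set p" "j \<in> set p"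
  obtains q where "q \<noteq> []" "hd q = k" "last q = j" "distinct q"
    "successively (\<lambda>u v. cycle_map p u = Some v) q"
proof -
  obtain s where s: "s < length p" "p ! s = k"
    using assms by (metis in_set_conv_nth)
  define r where "r = rotate s p"
  have r: "length r = length p" "distinct r" "set r = set p"
    using assms by (auto simp: r_def)
  have r_nth: "r ! t = p ! ((s + t) mod length p)" if "t < length p" for t
    using that by (simp add: r_def nth_rotate add.commute)
  obtain m where m: "m < length r" "r ! m = j"
    using assms r by (metis in_set_conv_nth)
  have step: "cycle_map p (r ! t) = Some (r ! Suc t)" if "Suc t < length r" for t
  proof -
    have "(s + t) mod length p < length p"
      using s by (intro mod_less_divisor) linarith
    then have "cycle_map p (r ! t) = Some (p ! (Suc ((s + t) mod length p) mod length p))"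
      using that r assms(1) by (simp add: r_nth cycle_map_nth)
    with that r show ?thesis by (simp add: r_nth mod_Suc_eq)
  qed
  show thesis
  proof
    show "take (Suc m) r \<noteq> []" using m by auto
    show "hd (take (Suc m) r) = k"
      using m r s r_nth[of 0] by (simp add: hd_conv_nth flip: length_greater_0_conv)
    show "last (take (Suc m) r) = j"
      using m by (simp add: take_Suc_conv_app_nth)
    show "distinct (take (Suc m) r)" using r by simp
    show "successively (\<lambda>u v. cycle_map p u = Some v) (take (Suc m) r)"
      using step m by (auto simp: successively_conv_nth)
  qed
qed

lemma unit_cycle_potential_exists:
  fixes A :: "real^'n^'n"
  assumes A: "\<forall>r s. 0 \<le> A $ r $ s"
    and p: "p \<noteq> []" "distinct p" "walk A (p @ [hd p])" "walk_weight A (p @ [hd p]) = 1"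
  obtains y :: "'n \<Rightarrow> real"
  where "\<And>u. u \<in> set p \<Longrightarrow> 0 < y u"
    and "\<And>u v. cycle_map p u = Some v \<Longrightarrow> A $ u $ v * y v = y u"
proof -
  \<comment> \<open>The weight of the part of the cycle from a node back to the first node of \<open>p\<close>.\<close>
  define y where
    "y u = walk_weight A (drop (inv_into {..<length p} ((!) p) u) p @ [hd p])" for u
  have y: "y (p ! s) = walk_weight A (drop s p @ [hd p])" if "s < length p" for s
    using that p by (simp add: y_def inv_into_f_f inj_on_nth)
  show thesis
  proof
    fix u assume "u \<in> set p"
    then obtain s where s: "s < length p" "u = p ! s" by (metis in_set_conv_nth)
    have "successively (\<lambda>i j. (i, j) \<in> edges A) (take s p @ drop s p @ [hd p])"
      using p by (simp add: walk_def flip: append_assoc)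
    then have "successively (\<lambda>i j. (i, j) \<in> edges A) (drop s p @ [hd p])"
      by (simp only: successively_append_iff)
    with A s show "0 < y u" by (simp add: y walk_weight_pos)
  next
    fix u v assume uv: "cycle_map p u = Some v"
    then have "u \<in> set p" using dom_cycle_map by fast
    then obtain s where s: "s < length p" "u = p ! s" by (metis in_set_conv_nth)
    with uv p have v: "v = p ! (Suc s mod length p)" by (simp add: cycle_map_nth)
    have u: "y u = walk_weight A (u # drop (Suc s) p @ [hd p])"
      using s by (simp add: y flip: Cons_nth_drop_Suc)
    show "A $ u $ v * y v = y u"
    proof (cases "Suc s < length p")
      case True
      then have "drop (Suc s) p = v # drop (Suc (Suc s)) p"
        using v by (simp add: Cons_nth_drop_Suc)
      with True u v show ?thesis by (simp add: y)
    next
      \<comment> \<open>This is the closing edge, the only place where weight 1 enters: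
        \<open>y (hd p)\<close> is the weight of the whole cycle.\<close>
      case False
      with s have "Suc s = length p" by simp
      with v p u y[of 0] show ?thesis by (simp add: hd_conv_nth)
    qed
  qed
qed

lemma cycle_path_weight:
  assumes p: "distinct p"
    and pos: "\<And>u. u \<in> set p \<Longrightarrow> 0 < (y u :: real)"
    and pot: "\<And>u v. cycle_map p u = Some v \<Longrightarrow> A $ u $ v * y v = y u"
    and kj: "k \<in> set p" "j \<in> set p"
  shows "walk_weight A (cycle_path (cycle_map p) k j) = y k / y j"
proof -
  obtain q where q: "q \<noteq> []" "hd q = k" "last q = j" "distinct q"
    "successively (\<lambda>u v. cycle_map p u = Some v) q"
    using cycle_map_path_exists[OF p kj] by blast
  have "cycle_path (cycle_map p) k j = q"
    unfolding cycle_path_def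
  proof (rule the_equality)
    fix q' assume "q' \<noteq> [] \<and> hd q' = k \<and> last q' = j \<and> distinct q' \<and>
      successively (\<lambda>u v. cycle_map p u = Some v) q'"
    with q show "q' = q"
      by (intro distinct_functional_path_unique) auto
  qed (use q in simp)
  moreover have "walk_weight A q = y (hd q) / y (last q)"
  proof (rule walk_weight_potential[OF q(1) q(5)])
    fix u v assume uv: "cycle_map p u = Some v"
    then have "u \<in> set p" "v \<in> set p"
      using dom_cycle_map[of p] ran_cycle_map[OF p] by (auto intro: ranI)
    then have "0 < y u" "0 < y v" by (auto intro: pos)
    with pot[OF uv] show "A $ u $ v = y u / y v \<and> y u \<noteq> 0 \<and> y v \<noteq> 0"
      by (simp add: field_simps)
  qed (use q kj pos[of k] in simp)
  ultimately show ?thesis using q by simp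
qed

section \<open>Deleted entries and witnesses off the cycle\<close>

text \<open>By injectivity only \<open>k\<close> has \<open>t\<close> as its successor. So
  \<open>k\<close> switches to the witness \<open>l\<close>, while every other node with a nonzero
  entry keeps its successor.\<close>

lemma Vstar_zero_entry:
  assumes x: "\<And>k. 0 \<le> x $ k"
    and outside: "\<And>k. k \<notin> dom \<tau> \<Longrightarrow> x $ k = 0"
    and pot: "\<And>u v. \<tau> u = Some v \<Longrightarrow> A $ u $ v * x $ v = x $ u"
    and inj: "inj_on \<tau> (dom \<tau>)"
    and t: "\<tau> k = Some t" and l: "l \<noteq> t" "x $ k \<le> A $ k $ l * x $ l"
  shows "(\<chi> j. if j = t then 0 else x $ j) \<in> Vstar A" (is "?v \<in> _")
  unfolding mem_Vstar_iff
proof (intro allI conjI)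
  fix u
  show "0 \<le> ?v $ u" using x by simp
  consider "u = t \<or> u \<notin> dom \<tau>" | "u = k" "u \<noteq> t" | v where "u \<noteq> k" "u \<noteq> t" "\<tau> u = Some v"
    by blast
  then show "\<exists>m. ?v $ u \<le> A $ u $ m * ?v $ m"
  proof cases
    case 1
    then have "?v $ u = 0" using outside[of u] by (auto simp del: domIff)
    then have "?v $ u \<le> A $ u $ t * ?v $ t" by simp
    then show ?thesis ..
  next
    case 2
    then have "?v $ u \<le> A $ u $ l * ?v $ l" using l by simp
    then show ?thesis ..
  next
    case 3
    then have "v \<noteq> t" using inj t by (metis domI inj_onD)
    with 3 pot have "?v $ u \<le> A $ u $ v * ?v $ v" by simp
    then show ?thesis ..
  qed
qed

text \<open>A witness for \<open>v\<close> at \<open>k\<close> also serves \<open>x\<close>, since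
  \<open>v\<close> lies below \<open>x\<close>. It cannot be \<open>t\<close>: there
  \<open>x\<close> attains equality, which would force \<open>v $ t\<close> up to
  \<open>x $ t\<close>.\<close>

lemma Vstar_component_exit:
  assumes A: "\<forall>r s. 0 \<le> A $ r $ s"
    and pos: "\<And>k. k \<in> dom \<tau> \<Longrightarrow> 0 < x $ k"
    and outside: "\<And>k. k \<notin> dom \<tau> \<Longrightarrow> x $ k = 0"
    and pot: "\<And>u v. \<tau> u = Some v \<Longrightarrow> A $ u $ v * x $ v = x $ u"
    and v: "v \<in> Vstar A" "\<And>j. v $ j \<le> x $ j"
    and k: "\<tau> k = Some t" "v $ k = x $ k" "v $ t \<noteq> x $ t"
  obtains l where "l \<in> dom \<tau>" "l \<noteq> t" "(k, l) \<in> edges A" "x $ k \<le> A $ k $ l * x $ l"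
proof -
  obtain l where l: "x $ k \<le> A $ k $ l * v $ l"
    using v(1) k by (metis mem_Vstar_iff)
  also have "\<dots> \<le> A $ k $ l * x $ l"
    using A v(2) by (simp add: mult_left_mono)
  finally have le: "x $ k \<le> A $ k $ l * x $ l" .
  have "0 < x $ k" using k pos by blast
  with le have nz: "A $ k $ l \<noteq> 0" "x $ l \<noteq> 0" by auto
  have "l \<noteq> t"
  proof
    assume "l = t"
    with l pot[OF k(1)] have "A $ k $ t * x $ t \<le> A $ k $ t * v $ t" by simp
    moreover have "0 < A $ k $ t" using A nz \<open>l = t\<close> by (simp add: less_le)
    ultimately have "x $ t \<le> v $ t" by simp
    with v(2)[of t] k show False by simp
  qed
  moreover have "l \<in> dom \<tau>" using nz outside by blast
  ultimately show thesis using that le nz by (simp add: edges_def)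
qed

theorem theorem3p6:
  fixes A :: "real^'n^'n" and \<tau> :: "'n \<rightharpoonup> 'n" and i :: 'n
  assumes "\<forall>r s. 0 \<le> A $ r $ s"
    and "\<tau> \<in> unit_cycles A"
    and "i \<in> dom \<tau>"
  shows "\<not> extremal (Vstar A) (cycle_vec A \<tau> i) \<longleftrightarrow>
    (\<exists>k1 l1 k2 l2. (k1, l1) \<in> edges A \<and> (k2, l2) \<in> edges A \<and>
       k1 \<in> dom \<tau> \<and> l1 \<in> dom \<tau> \<and> k2 \<in> dom \<tau> \<and> l2 \<in> dom \<tau> \<and>
       \<tau> k1 \<noteq> Some l1 \<and> \<tau> k2 \<noteq> Some l2 \<and> k1 \<noteq> k2 \<and>
       A $ k1 $ l1 * walk_weight A (cycle_path \<tau> l1 k1) \<ge> 1 \<and>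
       A $ k2 $ l2 * walk_weight A (cycle_path \<tau> l2 k2) \<ge> 1)"
proof -
  from assms(2) obtain p where \<tau>: "\<tau> = cycle_map p" and p: "p \<noteq> []" "distinct p"
    "walk A (p @ [hd p])" "walk_weight A (p @ [hd p]) = 1"
    by (auto simp: unit_cycles_def)
  have dom: "dom \<tau> = set p" and ran: "ran \<tau> = set p"
    using p by (simp_all add: \<tau> dom_cycle_map ran_cycle_map)
  have inj: "inj_on \<tau> (dom \<tau>)"
    unfolding dom using p by (simp add: \<tau> inj_on_cycle_map)
  obtain y where y_pos: "\<And>u. u \<in> set p \<Longrightarrow> 0 < y u"
    and y_pot: "\<And>u v. cycle_map p u = Some v \<Longrightarrow> A $ u $ v * y v = y u"
    using unit_cycle_potential_exists[OF assms(1) p] by blast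
  have weight: "walk_weight A (cycle_path \<tau> k j) = y k / y j"
    if "k \<in> dom \<tau>" "j \<in> dom \<tau>" for k j
    using cycle_path_weight[OF p(2) y_pos y_pot] that dom \<tau> by simp
  define x where "x = cycle_vec A \<tau> i"
  \<comment> \<open>On the support, \<open>x\<close> is the potential \<open>y\<close> rescaled to
    be 1 at \<open>i\<close>, so it inherits the edge identity of \<open>y\<close>.\<close>
  have x_in: "x $ j = y j / y i" if "j \<in> dom \<tau>" for j
    using that assms(3) by (simp add: x_def cycle_vec_def weight)
  have outside: "x $ j = 0" if "j \<notin> dom \<tau>" for j
    using that by (simp add: x_def cycle_vec_def)
  have y_i: "0 < y i" using assms(3) y_pos dom by simp
  have pos: "0 < x $ j" if "j \<in> dom \<tau>" for j
    using that y_i y_pos dom by (simp add: x_in)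
  have nonneg: "0 \<le> x $ j" for j
    using pos[of j] outside[of j] by (cases "j \<in> dom \<tau>") auto
  have pot: "A $ u $ v * x $ v = x $ u" if uv: "\<tau> u = Some v" for u v
  proof -
    have "u \<in> dom \<tau>" "v \<in> dom \<tau>"
      using uv dom ran by (auto intro: ranI)
    with y_pot[of u v] uv \<tau> show ?thesis by (simp add: x_in)
  qed
  have chord: "A $ k $ l * walk_weight A (cycle_path \<tau> l k) \<ge> 1 \<longleftrightarrow> x $ k \<le> A $ k $ l * x $ l"
    if "k \<in> dom \<tau>" "l \<in> dom \<tau>" for k l
    using that y_i y_pos[of k] dom by (simp add: weight x_in field_simps)
  have x_mem: "x \<in> Vstar A"
    unfolding mem_Vstar_iff
  proof (intro allI conjI)
    fix k
    show "0 \<le> x $ k" by (rule nonneg)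
    show "\<exists>l. x $ k \<le> A $ k $ l * x $ l"
    proof (cases "\<tau> k")
      case None
      then have "x $ k \<le> A $ k $ k * x $ k" by (simp add: outside domIff)
      then show ?thesis ..
    next
      case (Some t)
      then show ?thesis using pot by (metis order_refl)
    qed
  qed
  have leaves: "\<exists>k t. \<tau> k = Some t \<and> v $ k = x $ k \<and> v $ t \<noteq> x $ t"
    if vw: "x = v \<oplus>\<^sub>m w" "v \<in> Vstar A" "w \<in> Vstar A" "x \<noteq> v" "x \<noteq> w" for v w
  proof -
    have mx: "x $ j = max (v $ j) (w $ j)" for j
      using vw(1) by (simp add: max_add_def)
    \<comment> \<open>Both components are squeezed between 0 and \<open>x\<close>, so any
      disagreement with \<open>x\<close> lies on the support.\<close>
    have out: "v $ j = 0" "w $ j = 0" if "j \<notin> dom \<tau>" for j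
      using vw mx[of j] outside[OF that] by (auto simp: mem_Vstar_iff max_def split: if_splits intro: antisym)
    obtain j where j: "v $ j \<noteq> x $ j" using vw(4) by (metis vec_eq_iff)
    obtain k where k: "w $ k \<noteq> x $ k" using vw(5) by (metis vec_eq_iff)
    have "j \<in> dom \<tau>" "k \<in> dom \<tau>" using j k out outside by metis+
    then obtain q where q: "q \<noteq> []" "hd q = k" "last q = j"
      "successively (\<lambda>u v. \<tau> u = Some v) q"
      using cycle_map_path_exists[OF p(2)] dom \<tau> by metis
    \<comment> \<open>Where \<open>w\<close> falls short of \<open>x\<close>, the maximum comes from
      \<open>v\<close>. The path from \<open>k\<close> to \<open>j\<close> thus starts inside the
      agreement set of \<open>v\<close> and ends outside it.\<close>
    have "v $ k = x $ k" using k mx[of k] by (auto simp: max_def split: if_splits)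
    with successively_leaves[OF q(1,4), of "{u. v $ u = x $ u}"] q j show ?thesis by auto
  qed
  show ?thesis
    unfolding x_def[symmetric]
  proof
    assume "\<not> extremal (Vstar A) x"
    then obtain v w where vw: "x = v \<oplus>\<^sub>m w" "v \<in> Vstar A" "w \<in> Vstar A" "x \<noteq> v" "x \<noteq> w"
      using x_mem by (auto simp: extremal_def)
    then have wv: "x = w \<oplus>\<^sub>m v" by (simp add: max_add_def max.commute)
    have mx: "x $ j = max (v $ j) (w $ j)" for j
      using arg_cong[OF vw(1), of "\<lambda>z. z $ j"] by (simp add: max_add_def)
    then have le: "v $ j \<le> x $ j" "w $ j \<le> x $ j" for j by simp_all
    obtain k1 t1 where 1: "\<tau> k1 = Some t1" "v $ k1 = x $ k1" "v $ t1 \<noteq> x $ t1"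
      using leaves[OF vw] by blast
    obtain k2 t2 where 2: "\<tau> k2 = Some t2" "w $ k2 = x $ k2" "w $ t2 \<noteq> x $ t2"
      using leaves[OF wv vw(3,2,5,4)] by blast
    obtain l1 where l1: "l1 \<in> dom \<tau>" "l1 \<noteq> t1" "(k1, l1) \<in> edges A" "x $ k1 \<le> A $ k1 $ l1 * x $ l1"
      using Vstar_component_exit[of A \<tau> x, OF assms(1) pos outside pot vw(2) le(1) 1] by blast
    obtain l2 where l2: "l2 \<in> dom \<tau>" "l2 \<noteq> t2" "(k2, l2) \<in> edges A" "x $ k2 \<le> A $ k2 $ l2 * x $ l2"
      using Vstar_component_exit[of A \<tau> x, OF assms(1) pos outside pot vw(3) le(2) 2] by blast
    \<comment> \<open>The components cannot both miss \<open>x\<close> at one node; distinct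
      successors then give distinct tails.\<close>
    have "t1 \<noteq> t2" using 1 2 mx[of t1] by (auto simp: max_def split: if_splits)
    then have "k1 \<noteq> k2" using 1 2 by auto
    moreover have "k1 \<in> dom \<tau>" "k2 \<in> dom \<tau>" using 1 2 by auto
    ultimately show "\<exists>k1 l1 k2 l2. (k1, l1) \<in> edges A \<and> (k2, l2) \<in> edges A \<and>
       k1 \<in> dom \<tau> \<and> l1 \<in> dom \<tau> \<and> k2 \<in> dom \<tau> \<and> l2 \<in> dom \<tau> \<and>
       \<tau> k1 \<noteq> Some l1 \<and> \<tau> k2 \<noteq> Some l2 \<and> k1 \<noteq> k2 \<and>
       A $ k1 $ l1 * walk_weight A (cycle_path \<tau> l1 k1) \<ge> 1 \<and>
       A $ k2 $ l2 * walk_weight A (cycle_path \<tau> l2 k2) \<ge> 1"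
      using 1 2 l1 l2 chord by (metis option.inject)
  next
    assume "\<exists>k1 l1 k2 l2. (k1, l1) \<in> edges A \<and> (k2, l2) \<in> edges A \<and>
       k1 \<in> dom \<tau> \<and> l1 \<in> dom \<tau> \<and> k2 \<in> dom \<tau> \<and> l2 \<in> dom \<tau> \<and>
       \<tau> k1 \<noteq> Some l1 \<and> \<tau> k2 \<noteq> Some l2 \<and> k1 \<noteq> k2 \<and>
       A $ k1 $ l1 * walk_weight A (cycle_path \<tau> l1 k1) \<ge> 1 \<and>
       A $ k2 $ l2 * walk_weight A (cycle_path \<tau> l2 k2) \<ge> 1"
    then obtain k1 l1 k2 l2 where k: "k1 \<in> dom \<tau>" "k2 \<in> dom \<tau>" "k1 \<noteq> k2"
      and l: "\<tau> k1 \<noteq> Some l1" "\<tau> k2 \<noteq> Some l2"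
      and ge: "x $ k1 \<le> A $ k1 $ l1 * x $ l1" "x $ k2 \<le> A $ k2 $ l2 * x $ l2"
      using chord by blast
    obtain t1 t2 where t: "\<tau> k1 = Some t1" "\<tau> k2 = Some t2" using k by auto
    \<comment> \<open>Different deleted entries let each of the two vectors restore what the other
      lacks.\<close>
    have "t1 \<noteq> t2" using inj k t by (metis inj_onD)
    have "t1 \<in> dom \<tau>" "t2 \<in> dom \<tau>" using t dom ran by (auto intro: ranI)
    then have t_pos: "0 < x $ t1" "0 < x $ t2" by (auto intro: pos)
    define z where "z t = (\<chi> j. if j = t then 0 else x $ j)" for t
    have "z t1 \<in> Vstar A" "z t2 \<in> Vstar A"
      unfolding z_def
      using Vstar_zero_entry[of x \<tau> A, OF nonneg outside pot inj t(1) _ ge(1)]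
        Vstar_zero_entry[of x \<tau> A, OF nonneg outside pot inj t(2) _ ge(2)] l t by auto
    moreover have "x = z t1 \<oplus>\<^sub>m z t2"
      using \<open>t1 \<noteq> t2\<close> nonneg by (auto simp: vec_eq_iff max_add_def z_def max_def antisym)
    moreover have "x \<noteq> z t1" "x \<noteq> z t2"
      using t_pos by (auto simp: vec_eq_iff z_def)
    ultimately show "\<not> extremal (Vstar A) x"
      unfolding extremal_def by blast
  qed
qed

end
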